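(* Let $C_n$ denote the $n$-th Catalan number, i.e. the number of valid arrangements of $n$ pairs of parentheses. The function $f(n)=C_n$ (for $n\ge 1$) is a counting order invariant $\mathrm{MSOL}^2$-Specker function, and it does not satisfy a linear recurrence relation with constant coefficients modulo $2$.
   Context: $\mathbb{N}=\{0,1,2,\ldots\}$ and $[n]=\{1,\ldots,n\}$. Structures have nonempty universes, so all counting functions are considered for arguments $n\ge 1$. A function $f:\{1,2,\ldots\}\to\mathbb{N}$ satisfies a linear recurrence relation with constant coefficients modulo $m$ if there are $d\ge 1$ and integers $a_1,\ldots,a_d$ with $f(n)\equiv\sum_{j=1}^d a_j f(n-j)\pmod m$ for all $n>d$. $\mathrm{MSOL}$ is Monadic Second Order Logic (first order logic with equality extended by quantification over subsets of the universe). Let $\bar R=(R_1,\ldots,R_s)$ be a finite tuple of relation symbols, $R_i$ of arity $\rho(i)$. A class $\mathcal{D}$ of ordered $\bar R$-structures is a class of finite $\bar R\cup\{<_1\}$-structures in which the binary symbol $<_1$ is always interpreted as a linear order of the universe. It is definable in $\mathrm{MSOL}$ if there is an $\mathrm{MSOL}$-sentence $\phi$ over the vocabulary $\bar R\cup\{<_1\}$ such that an ordered $\bar R$-structure is in $\mathcal{D}$ iff it satisfies $\phi$. For a linear order $<_1$ of $[n]$ let $$osp_{\mathcal{D}}(n,<_1)=\big|\{(R_1,\ldots,R_s): R_i\subseteq[n]^{\rho(i)},\ \langle[n],<_1,R_1,\ldots,R_s\rangle\in\mathcal{D}\}\big|.$$ A function $f:\{1,2,\ldots\}\to\mathbb{N}$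 is a counting order invariant $\mathrm{MSOL}^k$-Specker function if there are a finite set of relation symbols $\bar R$ of arity at most $k$ and a class $\mathcal{D}$ of ordered $\bar R$-structures definable in $\mathrm{MSOL}$ such that for all $n\ge 1$ and all linear orders $<_1,<_2$ of $[n]$ we have $f(n)=osp_{\mathcal{D}}(n,<_1)=osp_{\mathcal{D}}(n,<_2)$. *)

theory Defs
  imports Main "HOL-Number_Theory.Cong"
begin

datatype paren = Open | Close

text \<open>The grammar is unambiguous: a nonempty valid word is split at the partner of its first letter.\<close>

inductive valid_parens :: "paren list \<Rightarrow> bool" where
  "valid_parens []"
| "valid_parens u \<Longrightarrow> valid_parens v \<Longrightarrow> valid_parens (Open # u @ Close # v)"

definition catalan :: "nat \<Rightarrow> nat" where
  "catalan n = card {w. valid_parens w \<and> length w = 2 * n}"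

text \<open>Functions on the positive integers are total functions on the naturals whose value at 0
  is never consulted: below, \<open>n - j \<ge> 1\<close> because \<open>j \<le> d < n\<close>.\<close>

definition linear_recurrence_mod :: "nat \<Rightarrow> (nat \<Rightarrow> nat) \<Rightarrow> bool" where
  "linear_recurrence_mod m f \<longleftrightarrow>
     (\<exists>d\<ge>1. \<exists>a :: nat \<Rightarrow> int. \<forall>n>d.
        [int (f n) = (\<Sum>j = 1..d. a j * int (f (n - j)))] (mod int m))"

text \<open>A vocabulary is given by the list of arities of its relation symbols; the binary symbol for
  the order is kept apart. A relation of arity \<open>r\<close> is a set of lists of length \<open>r\<close>.\<close>

type_synonym vocabulary = "nat list"

record 'a ostructure =
  universe :: "'a set"
  order :: "'a rel"
  relations :: "'a list set list"

text \<open>\<^const>\<open>strict_linear_order_on\<close> does not by itself confine the relation to the set.\<close>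

definition linear_order_of :: "'a set \<Rightarrow> 'a rel \<Rightarrow> bool" where
  "linear_order_of A r \<longleftrightarrow> r \<subseteq> A \<times> A \<and> strict_linear_order_on A r"

definition interpretations :: "vocabulary \<Rightarrow> 'a set \<Rightarrow> 'a list set list set" where
  "interpretations \<rho> A =
     {Rs. length Rs = length \<rho> \<and>
          (\<forall>i<length \<rho>. Rs ! i \<subseteq> {xs. length xs = \<rho> ! i \<and> set xs \<subseteq> A})}"

definition ordered_structure :: "vocabulary \<Rightarrow> 'a ostructure \<Rightarrow> bool" where
  "ordered_structure \<rho> M \<longleftrightarrow>
     finite (universe M) \<and> universe M \<noteq> {} \<and>
     linear_order_of (universe M) (order M) \<and>
     relations M \<in> interpretations \<rho> (universe M)"

text \<open>Element variables and set variables are two separate families, each named by naturals;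
  \<open>Mem x X\<close> says that element \<open>x\<close> belongs to set \<open>X\<close>.\<close>

datatype msol =
    Eq nat nat
  | Less nat nat
  | Rel nat "nat list"
  | Mem nat nat
  | Neg msol
  | Conj msol msol
  | Ex nat msol
  | ExSet nat msol

primrec sat :: "'a ostructure \<Rightarrow> (nat \<Rightarrow> 'a) \<Rightarrow> (nat \<Rightarrow> 'a set) \<Rightarrow> msol \<Rightarrow> bool" where
  "sat M e E (Eq x y) \<longleftrightarrow> e x = e y"
| "sat M e E (Less x y) \<longleftrightarrow> (e x, e y) \<in> order M"
| "sat M e E (Rel i xs) \<longleftrightarrow> map e xs \<in> relations M ! i"
| "sat M e E (Mem x X) \<longleftrightarrow> e x \<in> E X"
| "sat M e E (Neg \<phi>) \<longleftrightarrow> \<not> sat M e E \<phi>"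
| "sat M e E (Conj \<phi> \<psi>) \<longleftrightarrow> sat M e E \<phi> \<and> sat M e E \<psi>"
| "sat M e E (Ex x \<phi>) \<longleftrightarrow> (\<exists>a\<in>universe M. sat M (e(x := a)) E \<phi>)"
| "sat M e E (ExSet X \<phi>) \<longleftrightarrow> (\<exists>S\<subseteq>universe M. sat M e (E(X := S)) \<phi>)"

primrec over_vocabulary :: "vocabulary \<Rightarrow> msol \<Rightarrow> bool" where
  "over_vocabulary \<rho> (Eq x y) \<longleftrightarrow> True"
| "over_vocabulary \<rho> (Less x y) \<longleftrightarrow> True"
| "over_vocabulary \<rho> (Rel i xs) \<longleftrightarrow> i < length \<rho> \<and> length xs = \<rho> ! i"
| "over_vocabulary \<rho> (Mem x X) \<longleftrightarrow> True"
| "over_vocabulary \<rho> (Neg \<phi>) \<longleftrightarrow> over_vocabulary \<rho> \<phi>"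
| "over_vocabulary \<rho> (Conj \<phi> \<psi>) \<longleftrightarrow> over_vocabulary \<rho> \<phi> \<and> over_vocabulary \<rho> \<psi>"
| "over_vocabulary \<rho> (Ex x \<phi>) \<longleftrightarrow> over_vocabulary \<rho> \<phi>"
| "over_vocabulary \<rho> (ExSet X \<phi>) \<longleftrightarrow> over_vocabulary \<rho> \<phi>"

primrec free_vars :: "msol \<Rightarrow> nat set" where
  "free_vars (Eq x y) = {x, y}"
| "free_vars (Less x y) = {x, y}"
| "free_vars (Rel i xs) = set xs"
| "free_vars (Mem x X) = {x}"
| "free_vars (Neg \<phi>) = free_vars \<phi>"
| "free_vars (Conj \<phi> \<psi>) = free_vars \<phi> \<union> free_vars \<psi>"
| "free_vars (Ex x \<phi>) = free_vars \<phi> - {x}"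
| "free_vars (ExSet X \<phi>) = free_vars \<phi>"

primrec free_set_vars :: "msol \<Rightarrow> nat set" where
  "free_set_vars (Eq x y) = {}"
| "free_set_vars (Less x y) = {}"
| "free_set_vars (Rel i xs) = {}"
| "free_set_vars (Mem x X) = {X}"
| "free_set_vars (Neg \<phi>) = free_set_vars \<phi>"
| "free_set_vars (Conj \<phi> \<psi>) = free_set_vars \<phi> \<union> free_set_vars \<psi>"
| "free_set_vars (Ex x \<phi>) = free_set_vars \<phi>"
| "free_set_vars (ExSet X \<phi>) = free_set_vars \<phi> - {X}"

definition sentence :: "vocabulary \<Rightarrow> msol \<Rightarrow> bool" where
  "sentence \<rho> \<phi> \<longleftrightarrow> over_vocabulary \<rho> \<phi> \<and> free_vars \<phi> = {} \<and> free_set_vars \<phi> = {}"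

definition models :: "'a ostructure \<Rightarrow> msol \<Rightarrow> bool" where
  "models M \<phi> \<longleftrightarrow>
     (\<forall>e E. range e \<subseteq> universe M \<longrightarrow> range E \<subseteq> Pow (universe M) \<longrightarrow> sat M e E \<phi>)"

text \<open>A class of finite structures is represented by its members whose universe is a finite set of
  naturals. Nothing is lost: definable classes are closed under isomorphism, and every
  finite structure is isomorphic to one of these.\<close>

definition msol_definable :: "vocabulary \<Rightarrow> 'a ostructure set \<Rightarrow> bool" where
  "msol_definable \<rho> D \<longleftrightarrow>
     D \<subseteq> {M. ordered_structure \<rho> M} \<and>
     (\<exists>\<phi>. sentence \<rho> \<phi> \<and> (\<forall>M. ordered_structure \<rho> M \<longrightarrow> (M \<in> D \<longleftrightarrow> models M \<phi>)))"

definition osp :: "vocabulary \<Rightarrow> nat ostructure set \<Rightarrow> nat \<Rightarrow> nat rel \<Rightarrow> nat" where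
  "osp \<rho> D n r =
     card {Rs \<in> interpretations \<rho> {1..n}. \<lparr>universe = {1..n}, order = r, relations = Rs\<rparr> \<in> D}"

text \<open>Relation symbols have positive arity. A symbol of arity 0 could anyway be simulated by
  a unary symbol required to be empty or full.\<close>

definition order_invariant_specker :: "nat \<Rightarrow> (nat \<Rightarrow> nat) \<Rightarrow> bool" where
  "order_invariant_specker k f \<longleftrightarrow>
     (\<exists>\<rho> D. (\<forall>r\<in>set \<rho>. 1 \<le> r \<and> r \<le> k) \<and> msol_definable \<rho> D \<and>
        (\<forall>n\<ge>1. \<forall>r1 r2. linear_order_of {1..n} r1 \<longrightarrow> linear_order_of {1..n} r2 \<longrightarrow>
           f n = osp \<rho> D n r1 \<and> osp \<rho> D n r1 = osp \<rho> D n r2))"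

end

(* The pairs (<, R) with R an order ideal of the staircase {(x, y). y < x} are first order
   definable. Numbering the universe along <, such an R is the sequence of its row lengths, a
   monotone sequence f with f(i) <= i (0 <= i < n). Cutting it at the first i > 0 with f(i) = i
   gives the same recurrence as splitting a word of parentheses at the partner of its first letter.

   Modulo 2 the palindromic sum in this recurrence leaves only its middle term, so C(2k+1) = C(k)
   and C(2k+2) = 0: C(n) is odd exactly when n + 1 is a power of 2. Long runs of zeros followed
   by a one exclude any linear recurrence. *)

theory Submission
  imports Defs
begin

text \<open>Serves both Catalan recurrences below: words and staircase sequences each decompose into
  a size \<open>i\<close> and two parts of sizes \<open>i\<close> and \<open>n - i\<close>.\<close>

lemma card_convolution:
  fixes X :: "nat \<Rightarrow> 'a set"
  assumes "\<And>i. finite (X i)"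
    and "bij_betw f (SIGMA i:{..n}. X i \<times> X (n - i)) Y"
  shows "card Y = (\<Sum>i\<le>n. card (X i) * card (X (n - i)))"
  using bij_betw_same_card[OF assms(2)] assms(1)
  by (simp add: card_cartesian_product)

section \<open>Words of parentheses\<close>

definition valid_words :: "nat \<Rightarrow> paren list set" where
  "valid_words n = {w. valid_parens w \<and> length w = 2 * n}"

lemma even_length_valid: "valid_parens w \<Longrightarrow> even (length w)"
  by (induction rule: valid_parens.induct) auto

text \<open>No nonempty valid word starts with \<open>Close\<close>, so \<open>u\<close> and
  \<open>u'\<close> are both empty or both start with \<open>Open\<close>. In the second case the
  inner factors are compared by induction, first \<open>a\<close>, then \<open>b\<close>. This makes
  the splitting map in \<open>catalan_Suc\<close> injective.\<close>

lemma valid_parens_first_return_unique: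
  assumes "valid_parens u" "valid_parens u'" "u @ Close # v = u' @ Close # v'"
  shows "u = u' \<and> v = v'"
  using assms
proof (induction u arbitrary: u' v v' rule: valid_parens.induct)
  case 1
  from 1(1) show ?case
    by (cases rule: valid_parens.cases) (use 1 in auto)
next
  case (2 a b)
  from 2(5) show ?case
  proof (cases rule: valid_parens.cases)
    case 1
    then show ?thesis using 2(6) by simp
  next
    case (2 a' b')
    with \<open>(Open # a @ Close # b) @ Close # v = u' @ Close # v'\<close>
    \<comment> \<open>Dropping the leading \<open>Open\<close> and reassociating shows the same
      shape again, with \<open>a\<close> in the role of \<open>u\<close>; once \<open>a\<close> is
      cancelled, \<open>b\<close> takes that role.\<close>
    have "a @ Close # (b @ Close # v) = a' @ Close # (b' @ Close # v')" by simp
    with "2.IH"(1)[OF 2(2)] have "a = a'" "b @ Close # v = b' @ Close # v'" by blast+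
    with "2.IH"(2)[OF 2(3)] 2(1) show ?thesis by blast
  qed
qed

lemma finite_valid_words: "finite (valid_words n)"
proof -
  have "(UNIV :: paren set) = {Open, Close}"
    using paren.exhaust by blast
  then have "finite (UNIV :: paren set)"
    by (metis finite.emptyI finite.insertI)
  then have "finite {w :: paren list. set w \<subseteq> UNIV \<and> length w = 2 * n}"
    by (rule finite_lists_length_eq)
  then show ?thesis
    by (rule rev_finite_subset) (auto simp: valid_words_def)
qed

lemma catalan_eq_card: "catalan n = card (valid_words n)"
  by (simp add: catalan_def valid_words_def)

lemma catalan_0: "catalan 0 = 1"
proof -
  have "valid_words 0 = {[]}"
    by (auto simp: valid_words_def intro: valid_parens.intros)
  then show ?thesis by (simp add: catalan_eq_card)
qed

lemma catalan_Suc: "catalan (Suc n) = (\<Sum>i\<le>n. catalan i * catalan (n - i))"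
  unfolding catalan_eq_card
proof (rule card_convolution[OF finite_valid_words])
  let ?f = "\<lambda>(i::nat, u, v). Open # u @ Close # v"
  let ?S = "SIGMA i:{..n}. valid_words i \<times> valid_words (n - i)"
  have "inj_on ?f ?S"
  proof (rule inj_onI)
    fix p q assume "p \<in> ?S" "q \<in> ?S" "?f p = ?f q"
    moreover obtain i u v i' u' v' where pq: "p = (i, u, v)" "q = (i', u', v')"
      by (metis surj_pair)
    ultimately have *: "u \<in> valid_words i" "u' \<in> valid_words i'" "u @ Close # v = u' @ Close # v'"
      by auto
    then have "u = u' \<and> v = v'"
      by (intro valid_parens_first_return_unique) (auto simp: valid_words_def)
    with *(1,2) show "p = q" by (simp add: pq valid_words_def)
  qed
  moreover have "?f ` ?S = valid_words (Suc n)"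
  proof (rule equalityI; rule subsetI)
    fix w assume "w \<in> ?f ` ?S"
    then show "w \<in> valid_words (Suc n)"
      by (auto simp: valid_words_def intro: valid_parens.intros)
  next
    fix w assume "w \<in> valid_words (Suc n)"
    then have w: "valid_parens w" "length w = 2 * Suc n"
      by (auto simp: valid_words_def)
    from w(1) obtain u v where uv: "valid_parens u" "valid_parens v" "w = Open # u @ Close # v"
      using w(2) by cases auto
    obtain i j where ij: "length u = 2 * i" "length v = 2 * j"
      using uv even_length_valid by (meson evenE)
    then have "n = i + j" using uv(3) w(2) by simp
    with uv ij have "(i, u, v) \<in> ?S" "w = ?f (i, u, v)"
      by (auto simp: valid_words_def)
    then show "w \<in> ?f ` ?S" by (rule rev_image_eqI)
  qed
  ultimately show "bij_betw ?f ?S (valid_words (Suc n))"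
    by (simp add: bij_betw_def)
qed

section \<open>Staircase sequences\<close>

text \<open>These are the lattice paths staying weakly below the diagonal, recorded by their
  heights.\<close>

definition staircase_seqs :: "nat \<Rightarrow> nat list set" where
  "staircase_seqs n = {xs. length xs = n \<and> sorted xs \<and> (\<forall>i<n. xs ! i \<le> i)}"

lemma finite_staircase_seqs: "finite (staircase_seqs n)"
proof -
  have "finite {xs. set xs \<subseteq> {..n} \<and> length xs = n}"
    by (rule finite_lists_length_eq) simp
  then show ?thesis
    by (rule rev_finite_subset) (force simp: staircase_seqs_def in_set_conv_nth)
qed

text \<open>The entry at position 0 is forced to be 0. Moving \<open>u\<close> one place to the
  right without raising it keeps it strictly below the diagonal, while the shift of \<open>v\<close>
  makes it start on the diagonal, at position \<open>Suc (length u)\<close>.\<close>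

definition staircase_join :: "nat list \<Rightarrow> nat list \<Rightarrow> nat list" where
  "staircase_join u v = 0 # u @ map ((+) (Suc (length u))) v"

lemma staircase_join_in:
  assumes "u \<in> staircase_seqs i" "v \<in> staircase_seqs j"
  shows "staircase_join u v \<in> staircase_seqs (Suc (i + j))"
proof -
  have u: "length u = i" "sorted u" "\<And>k. k < i \<Longrightarrow> u ! k \<le> k"
    and v: "length v = j" "sorted v" "\<And>k. k < j \<Longrightarrow> v ! k \<le> k"
    using assms by (auto simp: staircase_seqs_def)
  \<comment> \<open>Needed where the two blocks meet: entries of \<open>u\<close> stay below
    \<open>i\<close>, those of the shifted \<open>v\<close> are at least
    \<open>Suc i\<close>.\<close>
  have lt: "x < i" if "x \<in> set u" for x
    using that u by (force simp: in_set_conv_nth)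
  have "sorted (staircase_join u v)"
    using u v by (auto simp: staircase_join_def sorted_append sorted_map dest: lt
        intro: sorted_wrt_mono_rel)
  moreover have "staircase_join u v ! k \<le> k" if "k < Suc (i + j)" for k
  proof (cases k)
    case (Suc l)
    show ?thesis
    proof (cases "l < i")
      case True
      then show ?thesis
        using Suc u(1) u(3)[of l] by (simp add: staircase_join_def nth_append)
    next
      case False
      then have "v ! (l - i) \<le> l - i" using Suc that by (intro v(3)) simp
      then have "i + v ! (l - i) \<le> l" using False by simp
      then show ?thesis
        using False Suc that u(1) v(1) by (simp add: staircase_join_def nth_append)
    qed
  qed (simp add: staircase_join_def)
  ultimately show ?thesis
    using u(1) v(1) by (simp add: staircase_seqs_def staircase_join_def)
qed

text \<open>If \<open>i < i'\<close>, then at position \<open>Suc i\<close> the first join meets the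
  diagonal, because \<open>v\<close> starts there, whereas the second is still inside
  \<open>u'\<close> and strictly below it. Used in both directions, this recovers the cutting
  point.\<close>

lemma staircase_join_length_le:
  assumes "u \<in> staircase_seqs i" "v \<in> staircase_seqs j"
    "u' \<in> staircase_seqs i'" "v' \<in> staircase_seqs j'"
    and eq: "staircase_join u v = staircase_join u' v'"
  shows "i' \<le> i"
proof (rule ccontr)
  assume "\<not> i' \<le> i"
  then have less: "i < i'" by simp
  have len: "length u = i" "length v = j" "length u' = i'" "length v' = j'"
    using assms by (auto simp: staircase_seqs_def)
  have "i + j = i' + j'"
    using arg_cong[OF eq, of length] len by (simp add: staircase_join_def)
  \<comment> \<open>So \<open>v\<close> is nonempty and position \<open>Suc i\<close>
    exists.\<close>
  then have "0 < j" using less by simp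
  then have "staircase_join u v ! Suc i = Suc i"
    using assms(2) len by (auto simp: staircase_join_def nth_append staircase_seqs_def)
  moreover have "staircase_join u' v' ! Suc i \<le> i"
    using assms(3) len less by (auto simp: staircase_join_def nth_append staircase_seqs_def)
  ultimately show False using eq by simp
qed

lemma staircase_join_surj:
  assumes "xs \<in> staircase_seqs (Suc n)"
  obtains m u v where "m \<le> n" "u \<in> staircase_seqs m" "v \<in> staircase_seqs (n - m)"
    "xs = staircase_join u v"
proof -
  have xs: "length xs = Suc n" "sorted xs" "\<And>i. i < Suc n \<Longrightarrow> xs ! i \<le> i"
    using assms by (auto simp: staircase_seqs_def)
  \<comment> \<open>\<open>m\<close> is the length of \<open>u\<close>, so the return to the
    diagonal is at position \<open>Suc m\<close>. The disjunct \<open>j = n\<close> covers a path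
    that never returns; then \<open>v\<close> is empty.\<close>
  define P where "P = (\<lambda>j. j = n \<or> xs ! Suc j = Suc j)"
  define m where "m = (LEAST j. P j)"
  have "P n" by (simp add: P_def)
  then have m: "P m" "m \<le> n" "\<And>j. j < m \<Longrightarrow> \<not> P j"
    unfolding m_def by (auto intro: LeastI Least_le dest: not_less_Least)
  define u where "u = take m (tl xs)"
  define v where "v = map (\<lambda>x. x - Suc m) (drop (Suc m) xs)"
  have u: "length u = m" "\<And>j. j < m \<Longrightarrow> u ! j = xs ! Suc j"
    using xs(1) m(2) by (auto simp: u_def nth_tl)
  have v: "length v = n - m" "\<And>j. j < n - m \<Longrightarrow> v ! j = xs ! (Suc m + j) - Suc m"
    using xs(1) m(2) by (auto simp: v_def)
  have mono: "xs ! i \<le> xs ! j" if "i \<le> j" "j < Suc n" for i j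
    using xs(1,2) that by (simp add: sorted_nth_mono)
  have u_in: "u \<in> staircase_seqs m"
  proof -
    \<comment> \<open>Before the cut the diagonal is avoided, which improves the bound
      \<open>Suc j\<close> on \<open>xs ! Suc j\<close> by one.\<close>
    have "u ! j \<le> j" if "j < m" for j
      using u(2)[OF that] m(3)[OF that] xs(3)[of "Suc j"] that m(2) by (auto simp: P_def)
    moreover have "sorted u"
      unfolding sorted_iff_nth_mono using u m(2) mono by auto
    ultimately show ?thesis using u(1) by (simp add: staircase_seqs_def)
  qed
  have v_in: "v \<in> staircase_seqs (n - m)"
  proof -
    have "v ! j \<le> j" if "j < n - m" for j
    proof -
      have "xs ! (Suc m + j) \<le> Suc m + j" using that by (intro xs(3)) simp
      then show ?thesis unfolding v(2)[OF that] by linarith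
    qed
    moreover have "sorted v"
      unfolding sorted_iff_nth_mono using v mono by (auto intro!: diff_le_mono)
    ultimately show ?thesis using v(1) by (simp add: staircase_seqs_def)
  qed
  have "xs = staircase_join u v"
  proof (rule nth_equalityI)
    show "length xs = length (staircase_join u v)"
      using xs(1) u(1) v(1) m(2) by (simp add: staircase_join_def)
    fix k assume "k < length xs"
    then have k: "k < Suc n" using xs(1) by simp
    show "xs ! k = staircase_join u v ! k"
    proof (cases k)
      case 0
      then show ?thesis using xs(3)[of 0] by (simp add: staircase_join_def)
    next
      case (Suc l)
      show ?thesis
      proof (cases "l < m")
        case True
        then show ?thesis using Suc u by (simp add: staircase_join_def nth_append)
      next
        case False
        \<comment> \<open>From the return on, monotonicity keeps all entries at least
          \<open>Suc m\<close>, so the truncated subtraction in \<open>v\<close> is undone by the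
          shift in the join.\<close>
        then have "xs ! Suc m = Suc m" using m(1) k Suc by (auto simp: P_def)
        then have "Suc m \<le> xs ! k" using mono[of "Suc m" k] False Suc k by simp
        then show ?thesis
          using False Suc u(1) v k by (simp add: staircase_join_def nth_append)
      qed
    qed
  qed
  with u_in v_in m(2) that show ?thesis by blast
qed

lemma card_staircase_seqs_Suc:
  "card (staircase_seqs (Suc n)) = (\<Sum>i\<le>n. card (staircase_seqs i) * card (staircase_seqs (n - i)))"
proof (rule card_convolution[OF finite_staircase_seqs])
  let ?f = "\<lambda>(i::nat, u, v). staircase_join u v"
  let ?S = "SIGMA i:{..n}. staircase_seqs i \<times> staircase_seqs (n - i)"
  have "inj_on ?f ?S"
  proof (rule inj_onI)
    fix p q assume "p \<in> ?S" "q \<in> ?S" "?f p = ?f q"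
    moreover obtain i u v i' u' v' where pq: "p = (i, u, v)" "q = (i', u', v')"
      by (metis surj_pair)
    ultimately have *: "u \<in> staircase_seqs i" "v \<in> staircase_seqs (n - i)"
      "u' \<in> staircase_seqs i'" "v' \<in> staircase_seqs (n - i')"
      "staircase_join u v = staircase_join u' v'"
      by auto
    have "i = i'"
      using staircase_join_length_le[OF *] staircase_join_length_le[OF *(3,4,1,2) *(5)[symmetric]]
      by simp
    with * show "p = q"
      by (auto simp: pq staircase_join_def staircase_seqs_def map_injective)
  qed
  moreover have "?f ` ?S = staircase_seqs (Suc n)"
  proof (rule equalityI; rule subsetI)
    fix xs assume "xs \<in> ?f ` ?S"
    then show "xs \<in> staircase_seqs (Suc n)"
      using staircase_join_in by fastforce
  next
    fix xs assume "xs \<in> staircase_seqs (Suc n)"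
    then obtain m u v where "(m, u, v) \<in> ?S" "xs = ?f (m, u, v)"
      by (elim staircase_join_surj) auto
    then show "xs \<in> ?f ` ?S" by (rule rev_image_eqI)
  qed
  ultimately show "bij_betw ?f ?S (staircase_seqs (Suc n))"
    by (simp add: bij_betw_def)
qed

lemma card_staircase_seqs: "card (staircase_seqs n) = catalan n"
proof (induction n rule: less_induct)
  case (less n)
  show ?case
  proof (cases n)
    case 0
    have "staircase_seqs 0 = {[]}" by (auto simp: staircase_seqs_def)
    then show ?thesis using 0 by (simp add: catalan_0)
  next
    case (Suc k)
    then show ?thesis using less by (simp add: card_staircase_seqs_Suc catalan_Suc)
  qed
qed

section \<open>Order ideals of the staircase\<close>

text \<open>With \<open>[x, y]\<close> read as the interval from \<open>y\<close> up to
  \<open>x\<close>, this is a family of nondegenerate intervals closed under enlargement at either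
  end. Quantifiers range over \<open>A\<close> to match the semantics of \<open>Ex\<close>.\<close>

definition staircase_ideal :: "'a set \<Rightarrow> 'a rel \<Rightarrow> 'a list set \<Rightarrow> bool" where
  "staircase_ideal A r R \<longleftrightarrow>
     (\<forall>x\<in>A. \<forall>y\<in>A. [x, y] \<in> R \<longrightarrow> (y, x) \<in> r) \<and>
     (\<forall>x\<in>A. \<forall>y\<in>A. \<forall>z\<in>A. [x, y] \<in> R \<longrightarrow> (z, y) \<in> r \<longrightarrow> [x, z] \<in> R) \<and>
     (\<forall>x\<in>A. \<forall>y\<in>A. \<forall>z\<in>A. [x, y] \<in> R \<longrightarrow> (x, z) \<in> r \<longrightarrow> [z, y] \<in> R)"

text \<open>Each conjunct denies a counterexample to one clause of \<open>staircase_ideal\<close>,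
  as \<open>msol\<close> has only existential quantifiers. No set quantifier occurs.\<close>

definition staircase_formula :: msol where
  "staircase_formula =
     Conj (Neg (Ex 0 (Ex 1 (Conj (Rel 0 [0, 1]) (Neg (Less 1 0))))))
    (Conj (Neg (Ex 0 (Ex 1 (Ex 2
            (Conj (Rel 0 [0, 1]) (Conj (Less 2 1) (Neg (Rel 0 [0, 2]))))))))
          (Neg (Ex 0 (Ex 1 (Ex 2
            (Conj (Rel 0 [0, 1]) (Conj (Less 0 2) (Neg (Rel 0 [2, 1])))))))))"

lemma sentence_staircase_formula: "sentence [2] staircase_formula"
  by (auto simp: sentence_def staircase_formula_def)

lemma sat_staircase_formula:
  "sat M e E staircase_formula \<longleftrightarrow> staircase_ideal (universe M) (order M) (relations M ! 0)"
  by (simp add: staircase_formula_def staircase_ideal_def)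

text \<open>\<open>models\<close> ranges over all assignments into the universe; nonemptiness
  supplies at least one, so that it is not vacuously true.\<close>

lemma models_staircase_formula:
  assumes "universe M \<noteq> {}"
  shows "models M staircase_formula \<longleftrightarrow>
    staircase_ideal (universe M) (order M) (relations M ! 0)"
proof -
  obtain a where "a \<in> universe M" using assms by blast
  then have "range (\<lambda>_::nat. a) \<subseteq> universe M" "range (\<lambda>_::nat. {}) \<subseteq> Pow (universe M)"
    by auto
  then show ?thesis unfolding models_def sat_staircase_formula by blast
qed

text \<open>The number of predecessors is strictly monotone along \<open>r\<close>, hence injective
  on \<open>A\<close>, and smaller than \<open>card A\<close> since no element precedes itself. It
  is therefore a bijection onto \<open>{..<card A}\<close>, and \<open>z\<close> is its
  inverse.\<close>

lemma linear_order_enumeration: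
  assumes fin: "finite A" and lin: "linear_order_of A r"
  obtains z where "bij_betw z {..<card A} A"
    "\<And>i j. i < card A \<Longrightarrow> j < card A \<Longrightarrow> (z i, z j) \<in> r \<longleftrightarrow> i < j"
proof -
  have r: "r \<subseteq> A \<times> A" "trans r" "irrefl r" "total_on A r"
    using lin by (auto simp: linear_order_of_def strict_linear_order_on_def)
  define k where "k = (\<lambda>x. card {y \<in> A. (y, x) \<in> r})"
  have mono: "k x < k y" if "(x, y) \<in> r" for x y
    unfolding k_def
  proof (rule psubset_card_mono)
    show "finite {z \<in> A. (z, y) \<in> r}" using fin by simp
    have "x \<in> A" using that r(1) by blast
    then show "{z \<in> A. (z, x) \<in> r} \<subset> {z \<in> A. (z, y) \<in> r}"
      using that transD[OF r(2)] irreflD[OF r(3)] by blast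
  qed
  have inj: "inj_on k A"
  proof (rule inj_onI, rule ccontr)
    fix x y assume "x \<in> A" "y \<in> A" "k x = k y" "x \<noteq> y"
    then show False using r(4) mono unfolding total_on_def by (metis less_irrefl)
  qed
  have "k ` A \<subseteq> {..<card A}"
  proof clarsimp
    fix x assume "x \<in> A"
    then show "k x < card A"
      unfolding k_def using irreflD[OF r(3)] by (intro psubset_card_mono[OF fin]) blast
  qed
  then have "k ` A = {..<card A}"
    using inj by (intro card_subset_eq) (auto simp: card_image)
  with inj have "bij_betw k A {..<card A}" by (simp add: bij_betw_def)
  then have z: "bij_betw (inv_into A k) {..<card A} A"
    and kz: "\<And>i. i < card A \<Longrightarrow> k (inv_into A k i) = i"
    by (auto simp: bij_betw_inv_into bij_betw_inv_into_right)
  show ?thesis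
  proof (rule that[OF z])
    fix i j assume ij: "i < card A" "j < card A"
    let ?x = "inv_into A k i" and ?y = "inv_into A k j"
    have "?x \<in> A" "?y \<in> A" using z ij by (auto dest: bij_betwE)
    then show "(?x, ?y) \<in> r \<longleftrightarrow> i < j"
      using mono[of ?x ?y] mono[of ?y ?x] kz ij r(4)
      unfolding total_on_def by (metis less_asym less_irrefl)
  qed
qed

text \<open>Along the enumeration \<open>z\<close> every row of an ideal is an initial segment, so
  the ideal is determined by its row lengths. The resulting count does not depend on
  \<open>r\<close>.\<close>

lemma card_staircase_ideals:
  assumes fin: "finite A" and lin: "linear_order_of A r"
  shows "card {R. R \<subseteq> {xs. length xs = 2 \<and> set xs \<subseteq> A} \<and> staircase_ideal A r R} = catalan (card A)"
proof -
  define n where "n = card A"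
  obtain z where z: "bij_betw z {..<n} A"
    and zr: "\<And>i j. i < n \<Longrightarrow> j < n \<Longrightarrow> (z i, z j) \<in> r \<longleftrightarrow> i < j"
    using linear_order_enumeration[OF fin lin] unfolding n_def by blast
  have zA: "z i \<in> A" if "i < n" for i using z that by (auto dest: bij_betwE)
  have zinj: "z i = z j \<longleftrightarrow> i = j" if "i < n" "j < n" for i j
    using z that by (auto simp: bij_betw_def inj_on_def)
  have A: "A = z ` {..<n}" using z by (simp add: bij_betw_def)
  let ?I = "{R. R \<subseteq> {xs. length xs = 2 \<and> set xs \<subseteq> A} \<and> staircase_ideal A r R}"
  \<comment> \<open>Row \<open>i\<close> consists of the first \<open>xs ! i\<close>
    columns.\<close>
  define F where "F = (\<lambda>xs. {[z i, z j] | i j. i < n \<and> j < n \<and> j < xs ! i})"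
  have F: "[z i, z j] \<in> F xs \<longleftrightarrow> j < xs ! i" if "i < n" "j < n" for i j xs
    using that zinj by (auto simp: F_def)
  have F_in: "F xs \<in> ?I" if "xs \<in> staircase_seqs n" for xs
  proof -
    have xs: "length xs = n" "sorted xs" "\<And>i. i < n \<Longrightarrow> xs ! i \<le> i"
      using that by (auto simp: staircase_seqs_def)
    \<comment> \<open>Monotone row lengths are what closure in the row direction requires.\<close>
    have up: "y < xs ! z" if "y < xs ! x" "x < z" "z < n" for x y z
      using sorted_nth_mono[OF xs(2), of x z] that xs(1) by simp
    have "staircase_ideal A r (F xs)"
      unfolding staircase_ideal_def A
      using xs(3) up by (auto simp: F zr intro: less_le_trans)
    moreover have "F xs \<subseteq> {ys. length ys = 2 \<and> set ys \<subseteq> A}"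
      using zA by (auto simp: F_def)
    ultimately show ?thesis by simp
  qed
  have "inj_on F (staircase_seqs n)"
  proof (rule inj_onI)
    fix xs ys assume *: "xs \<in> staircase_seqs n" "ys \<in> staircase_seqs n" "F xs = F ys"
    show "xs = ys"
    proof (rule nth_equalityI)
      show "length xs = length ys" using * by (simp add: staircase_seqs_def)
      fix i assume "i < length xs"
      then have i: "i < n" "xs ! i < n" "ys ! i < n"
        using * by (auto simp: staircase_seqs_def intro: le_less_trans)
      \<comment> \<open>Both entries are below \<open>n\<close>, so each may be taken as the column
        \<open>j\<close>; the smaller one would separate the rows.\<close>
      have "j < xs ! i \<longleftrightarrow> j < ys ! i" if "j < n" for j
        using *(3) F[OF i(1) that] by metis
      with i show "xs ! i = ys ! i"
        by (metis less_irrefl linorder_neqE_nat)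
    qed
  qed
  moreover have "F ` staircase_seqs n = ?I"
  proof (rule equalityI; rule subsetI)
    fix R assume "R \<in> F ` staircase_seqs n"
    then show "R \<in> ?I" using F_in by blast
  next
    fix R assume "R \<in> ?I"
    then have sub: "R \<subseteq> {xs. length xs = 2 \<and> set xs \<subseteq> A}" and ideal: "staircase_ideal A r R"
      by auto
    have lt: "j < i" if "i < n" "j < n" "[z i, z j] \<in> R" for i j
      using ideal that zA zr unfolding staircase_ideal_def by blast
    have row: "[z i, z j'] \<in> R" if "i < n" "j < n" "[z i, z j] \<in> R" "j' < j" for i j j'
      using ideal that zA[of i] zA[of j] zA[of j'] zr[of j' j] unfolding staircase_ideal_def
      by (meson less_trans)
    have col: "[z i', z j] \<in> R" if "i' < n" "j < n" "[z i, z j] \<in> R" "i < i'" for i i' j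
      using ideal that zA[of i] zA[of j] zA[of i'] zr[of i i'] unfolding staircase_ideal_def
      by (meson less_trans)
    \<comment> \<open>The first column missing from row \<open>i\<close>. The diagonal cell is
      always missing, so the minimum exists and is at most \<open>i\<close>, which keeps it in the
      range where \<open>z\<close> enumerates \<open>A\<close>.\<close>
    define c where "c = (\<lambda>i. LEAST j. [z i, z j] \<notin> R)"
    have out: "[z i, z i] \<notin> R" if "i < n" for i using lt[of i i] that by blast
    have c_le: "c i \<le> i" if "i < n" for i
      unfolding c_def using out[OF that] by (rule Least_le)
    have c_out: "[z i, z (c i)] \<notin> R" if "i < n" for i
      unfolding c_def using out[OF that] by (rule LeastI)
    have c: "[z i, z j] \<in> R \<longleftrightarrow> j < c i" if "i < n" "j < n" for i j
    proof
      assume R: "[z i, z j] \<in> R"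
      show "j < c i"
        using row[OF that R, of "c i"] c_out[OF that(1)] R by (metis linorder_neqE_nat)
    next
      assume "j < c i"
      then show "[z i, z j] \<in> R" unfolding c_def using not_less_Least by blast
    qed
    \<comment> \<open>Otherwise column \<open>c j\<close> would be present in row \<open>i\<close>,
      and closure would carry it to the later row \<open>j\<close>, where it is missing.\<close>
    have c_mono: "c i \<le> c j" if "i \<le> j" "j < n" for i j
    proof (rule ccontr)
      assume "\<not> c i \<le> c j"
      then have "c j < c i" by simp
      moreover have "c j < n" "i < n" using c_le[of j] that by auto
      ultimately have "[z i, z (c j)] \<in> R" using c by blast
      with col[OF that(2) \<open>c j < n\<close>, of i] that c_out[of j] show False
        by (metis le_neq_implies_less)
    qed
    let ?xs = "map c [0..<n]"
    have "?xs \<in> staircase_seqs n"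
      using c_le c_mono by (auto simp: staircase_seqs_def sorted_iff_nth_mono)
    moreover have "R = F ?xs"
    proof (rule set_eqI)
      fix ys
      show "ys \<in> R \<longleftrightarrow> ys \<in> F ?xs"
      proof (cases "\<exists>i<n. \<exists>j<n. ys = [z i, z j]")
        case True
        then show ?thesis using c F by auto
      next
        case False
        then have "ys \<notin> F ?xs" by (auto simp: F_def)
        moreover have "ys \<notin> R"
        proof
          assume "ys \<in> R"
          then obtain x y where "ys = [x, y]" "x \<in> A" "y \<in> A"
            using sub by (auto simp: numeral_2_eq_2 length_Suc_conv)
          then show False using False A by auto
        qed
        ultimately show ?thesis by simp
      qed
    qed
    ultimately show "R \<in> F ` staircase_seqs n" by (rule rev_image_eqI)
  qed
  ultimately have "bij_betw F (staircase_seqs n) ?I" by (simp add: bij_betw_def)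
  then have "card (staircase_seqs n) = card ?I" by (rule bij_betw_same_card)
  then show ?thesis unfolding card_staircase_seqs n_def by (rule sym)
qed

section \<open>The definable class and its counting function\<close>

definition staircase_structures :: "'a ostructure set" where
  "staircase_structures = {M. ordered_structure [2] M \<and> models M staircase_formula}"

lemma msol_definable_staircase: "msol_definable [2] staircase_structures"
  using sentence_staircase_formula
  by (auto simp: msol_definable_def staircase_structures_def)

lemma osp_staircase:
  assumes "1 \<le> n" "linear_order_of {1..n} r"
  shows "osp [2] staircase_structures n r = catalan n"
proof -
  let ?I = "{R. R \<subseteq> {xs. length xs = 2 \<and> set xs \<subseteq> {1..n}} \<and> staircase_ideal {1..n} r R}"
  let ?O = "{Rs \<in> interpretations [2] {1..n}.
    \<lparr>universe = {1..n}, order = r, relations = Rs\<rparr> \<in> staircase_structures}"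
  \<comment> \<open>With a single relation symbol, an interpretation is a one-element list.\<close>
  have "Rs \<in> ?O \<longleftrightarrow> Rs \<in> (\<lambda>R. [R]) ` ?I" for Rs
    using assms
    by (cases Rs)
      (auto simp: staircase_structures_def ordered_structure_def models_staircase_formula
        interpretations_def)
  then have "?O = (\<lambda>R. [R]) ` ?I" by blast
  moreover have "card ((\<lambda>R. [R]) ` ?I) = card ?I"
    by (rule card_image) (simp add: inj_on_def)
  ultimately show ?thesis
    using card_staircase_ideals[OF _ assms(2)] by (simp add: osp_def)
qed

lemma order_invariant_specker_catalan: "order_invariant_specker 2 catalan"
  unfolding order_invariant_specker_def
  using msol_definable_staircase osp_staircase
  by (intro exI[of _ "[2]"] exI[of _ staircase_structures]) auto

section \<open>Parity\<close>

text \<open>The reflection of \<open>i\<close> to \<open>n - i\<close> exchanges the first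
  \<open>k\<close> terms with the last \<open>k\<close>. The middle range is left general: it is
  empty for \<open>n = 2 * k - 1\<close> with \<open>k\<close> positive, and a single term for
  \<open>n = 2 * k\<close>.\<close>

lemma sum_palindrome:
  fixes g :: "nat \<Rightarrow> nat"
  assumes "\<And>i. i \<le> n \<Longrightarrow> g (n - i) = g i" "2 * k \<le> Suc n"
  shows "sum g {..n} = 2 * sum g {..<k} + sum g {k..<Suc n - k}"
proof -
  have "sum g {Suc n - k..<Suc n} = sum g {..<k}"
    by (rule sum.reindex_bij_witness[of _ "\<lambda>i. n - i" "\<lambda>i. n - i"])
      (use assms in auto)
  moreover have "sum g {..n} = sum g {..<k} + sum g {k..<Suc n - k} + sum g {Suc n - k..<Suc n}"
    using assms(2)
    by (simp del: sum.op_ivl_Suc add: sum.atLeastLessThan_concat lessThan_Suc_atMost[symmetric]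
        lessThan_atLeast0)
  ultimately show ?thesis by simp
qed

lemma even_catalan_even: "even (catalan (2 * k + 2))"
proof -
  have "catalan (Suc (2 * k + 1)) = 2 * (\<Sum>i<Suc k. catalan i * catalan (2 * k + 1 - i))"
    unfolding catalan_Suc by (subst sum_palindrome[where k = "Suc k"]) auto
  then show ?thesis by simp
qed

lemma even_catalan_odd: "even (catalan (2 * k + 1)) \<longleftrightarrow> even (catalan k)"
proof -
  have "catalan (Suc (2 * k)) =
    2 * (\<Sum>i<k. catalan i * catalan (2 * k - i)) + catalan k * catalan k"
    unfolding catalan_Suc
    by (subst sum_palindrome[where k = k]) (auto simp: Suc_diff_le mult_2)
  then show ?thesis by simp
qed

text \<open>Placing \<open>Suc n\<close> between consecutive powers of 2 allows induction on the
  exponent: for \<open>n = 2 * m + 1\<close>, \<open>Suc n\<close> is twice \<open>Suc m\<close>, so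
  passing to \<open>m\<close> lowers \<open>k\<close> by one and preserves parity.\<close>

lemma odd_catalan_iff:
  assumes "2 ^ k \<le> Suc n" "Suc n < 2 ^ Suc k"
  shows "odd (catalan n) \<longleftrightarrow> Suc n = 2 ^ k"
  using assms
proof (induction k arbitrary: n)
  case 0
  then show ?case by (simp add: catalan_0)
next
  case (Suc k)
  show ?case
  proof (cases "even n")
    case True
    then obtain m where "n = 2 * m" by (elim evenE)
    \<comment> \<open>This excludes \<open>n = 0\<close>, the only even index with an odd Catalan
      number.\<close>
    moreover have "(2 :: nat) \<le> 2 ^ Suc k" by simp
    with Suc.prems(1) have "1 \<le> n" by linarith
    ultimately obtain l where l: "n = 2 * l + 2" by (cases m) auto
    have "even (2 ^ Suc k :: nat)" by simp
    with True have "Suc n \<noteq> 2 ^ Suc k" by (metis even_Suc)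
    then show ?thesis using even_catalan_even[of l] l by simp
  next
    case False
    then obtain m where m: "n = 2 * m + 1" by (elim oddE)
    then have "odd (catalan m) \<longleftrightarrow> Suc m = 2 ^ k" using Suc by (intro Suc.IH) auto
    then show ?thesis using even_catalan_odd[of m] m by auto
  qed
qed

section \<open>Failure of linear recurrences modulo 2\<close>

lemma not_linear_recurrence_mod_catalan: "\<not> linear_recurrence_mod 2 catalan"
proof
  assume "linear_recurrence_mod 2 catalan"
  then obtain d and a :: "nat \<Rightarrow> int" where
    rec: "\<And>n. n > d \<Longrightarrow> [int (catalan n) = (\<Sum>j = 1..d. a j * int (catalan (n - j)))] (mod 2)"
    unfolding linear_recurrence_mod_def by auto
  \<comment> \<open>\<open>Suc n\<close> is a power of 2, and since \<open>d < 2 ^ d\<close>, each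
    \<open>Suc (n - j)\<close> with \<open>j\<close> from 1 to \<open>d\<close> lies strictly
    between \<open>2 ^ d\<close> and \<open>2 ^ Suc d\<close>. The recurrence would thus give an odd
    value from even ones only.\<close>
  define n where "n = 2 ^ Suc d - (1 :: nat)"
  have d: "d < 2 ^ d" by (rule less_exp)
  then have n: "Suc n = 2 * 2 ^ d" by (simp add: n_def)
  have "even (catalan (n - j))" if "j \<in> {1..d}" for j
  proof -
    have "1 \<le> j" "j \<le> d" using that by auto
    then have "2 ^ d < Suc (n - j)" "Suc (n - j) < 2 ^ Suc d"
      unfolding power_Suc using n d by linarith+
    then show ?thesis using odd_catalan_iff[of d "n - j"] by auto
  qed
  then have "even (\<Sum>j = 1..d. a j * int (catalan (n - j)))"
    by (intro dvd_sum) simp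
  moreover have "odd (catalan n)"
    using odd_catalan_iff[of "Suc d" n] n by simp
  moreover have "n > d" using n d by linarith
  ultimately show False
    using rec[of n] cong_dvd_iff by (metis even_of_nat)
qed

theorem corollary22:
  shows "order_invariant_specker 2 catalan \<and> \<not> linear_recurrence_mod 2 catalan"
  using order_invariant_specker_catalan not_linear_recurrence_mod_catalan by blast

end
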